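(* Let $G$ be a graph of order $n$ and let $k$ be an integer with $k\le \min\{\delta(G),\delta(\overline{G})\}$. Then $$\gamma_{\times (k-1),t}^{r}(G)+\gamma_{\times (k-1),t}^{r}(\overline{G})\le \gamma_{\times k,t}^{r}(G\overline{G})\le \gamma_{\times k,t}^{r}(G)+\gamma_{\times k,t}^{r}(\overline{G}),$$ where the lower bound is asserted for $k\ge 2$ and the upper bound for $k\ge 1$.
   Context: All graphs are finite and simple; $N(x)$ denotes the open neighborhood of $x$, $\delta$ the minimum degree, and $\overline{G}$ the complement of $G$. For an integer $k\ge 1$, a set $S\subseteq V(H)$ is a $k$-tuple total dominating set of $H$ if $|N(x)\cap S|\ge k$ for every $x\in V(H)$. It is a $k$-tuple total restrained dominating set (kTRDS) if moreover every vertex $x\in V(H)\setminus S$ is adjacent to at least $k$ vertices of $V(H)\setminus S$; $\gamma_{\times k,t}^{r}(H)$ is the minimum cardinality of a kTRDS of $H$ (for $k=1$ this is the total restrained domination number). The complementary prism $G\overline{G}$ is the graph formed from the disjoint union of $G$ and $\overline{G}$ by adding a perfect matching joining each vertex of $G$ to its copy in $\overline{G}$. *)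

theory Defs
  imports Main "Graph_Theory.Pair_Digraph"
begin

text \<open>
  A finite simple graph is a \<^locale>\<open>pair_graph\<close>: a finite vertex set \<^const>\<open>pverts\<close> and a
  symmetric, irreflexive relation \<^const>\<open>parcs\<close> on it, each edge being represented by its two
  orientations.
\<close>

definition nbhd :: "'a pair_pre_digraph \<Rightarrow> 'a \<Rightarrow> 'a set" where
  "nbhd H x = {y. (x, y) \<in> parcs H}"

text \<open>The value for the graph without vertices is unspecified.\<close>

definition min_degree :: "'a pair_pre_digraph \<Rightarrow> nat" where
  "min_degree H = Min ((\<lambda>x. card (nbhd H x)) ` pverts H)"

definition graph_compl :: "'a pair_pre_digraph \<Rightarrow> 'a pair_pre_digraph" where
  "graph_compl G =
     \<lparr> pverts = pverts G,
       parcs = {(x, y). x \<in> pverts G \<and> y \<in> pverts G \<and> x \<noteq> y \<and> (x, y) \<notin> parcs G} \<rparr>"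

text \<open>
  In the disjoint union of \<open>G\<close> and its complement, the vertex \<open>x\<close> of \<open>G\<close> is \<^term>\<open>Inl x\<close> and its
  copy in the complement is \<^term>\<open>Inr x\<close>.
\<close>

definition compl_prism :: "'a pair_pre_digraph \<Rightarrow> ('a + 'a) pair_pre_digraph" where
  "compl_prism G =
     \<lparr> pverts = pverts G <+> pverts (graph_compl G),
       parcs = {(Inl x, Inl y) | x y. (x, y) \<in> parcs G}
             \<union> {(Inr x, Inr y) | x y. (x, y) \<in> parcs (graph_compl G)}
             \<union> {(Inl x, Inr x) | x. x \<in> pverts G}
             \<union> {(Inr x, Inl x) | x. x \<in> pverts G} \<rparr>"

definition tuple_total_dom :: "nat \<Rightarrow> 'a pair_pre_digraph \<Rightarrow> 'a set \<Rightarrow> bool" where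
  "tuple_total_dom k H S \<longleftrightarrow>
     S \<subseteq> pverts H \<and> (\<forall>x \<in> pverts H. k \<le> card (nbhd H x \<inter> S))"

definition tuple_total_restr_dom :: "nat \<Rightarrow> 'a pair_pre_digraph \<Rightarrow> 'a set \<Rightarrow> bool" where
  "tuple_total_restr_dom k H S \<longleftrightarrow>
     tuple_total_dom k H S \<and>
     (\<forall>x \<in> pverts H - S. k \<le> card (nbhd H x \<inter> (pverts H - S)))"

text \<open>
  The minimum is only meaningful if some \<open>k\<close>-tuple total restrained dominating set exists; this
  is the case iff \<open>k\<close> is at most every vertex degree, see below.
\<close>

definition tuple_total_restr_dom_number :: "nat \<Rightarrow> 'a pair_pre_digraph \<Rightarrow> nat" where
  "tuple_total_restr_dom_number k H =
     (LEAST m. \<exists>S. tuple_total_restr_dom k H S \<and> card S = m)"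


lemma (in pair_graph) nbhd_subset: "nbhd G x \<subseteq> pverts G"
  by (auto simp: nbhd_def dest: wellformed')

lemma (in pair_graph) ex_tuple_total_restr_dom_iff:
  "(\<exists>S. tuple_total_restr_dom k G S) \<longleftrightarrow> (\<forall>x \<in> pverts G. k \<le> card (nbhd G x))"
proof
  assume "\<exists>S. tuple_total_restr_dom k G S"
  then obtain S where S: "\<forall>x \<in> pverts G. k \<le> card (nbhd G x \<inter> S)"
    by (auto simp: tuple_total_restr_dom_def tuple_total_dom_def)
  have "card (nbhd G x \<inter> S) \<le> card (nbhd G x)" for x
    using finite_subset[OF nbhd_subset pair_finite_verts] by (intro card_mono) auto
  with S show "\<forall>x \<in> pverts G. k \<le> card (nbhd G x)"
    using order_trans by blast
next
  assume "\<forall>x \<in> pverts G. k \<le> card (nbhd G x)"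
  then have "tuple_total_restr_dom k G (pverts G)"
    by (simp add: tuple_total_restr_dom_def tuple_total_dom_def Int_absorb2 nbhd_subset)
  then show "\<exists>S. tuple_total_restr_dom k G S" ..
qed

lemma (in pair_graph) le_min_degree_iff:
  "pverts G \<noteq> {} \<Longrightarrow> k \<le> min_degree G \<longleftrightarrow> (\<forall>x \<in> pverts G. k \<le> card (nbhd G x))"
  using pair_finite_verts by (simp add: min_degree_def)

lemma pair_graphI:
  assumes "finite (pverts H)" "parcs H \<subseteq> pverts H \<times> pverts H"
    and "sym (parcs H)" "irrefl (parcs H)"
  shows "pair_graph H"
proof
  show "finite (parcs H)"
    using assms(1,2) by (meson finite_SigmaI finite_subset)
qed (use assms in \<open>auto simp: symmetric_def irrefl_def\<close>)

lemma (in pair_graph) pair_graph_sym: "sym (parcs G)"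
  using pair_sym_arcs by (simp add: symmetric_def)

lemma (in pair_graph) pair_graph_compl: "pair_graph (graph_compl G)"
  using pair_finite_verts pair_graph_sym
  by (intro pair_graphI) (auto simp: graph_compl_def sym_def irrefl_def)

lemma (in pair_graph) pair_graph_compl_prism: "pair_graph (compl_prism G)"
proof -
  have *: "(x, y) \<in> parcs G \<Longrightarrow> (y, x) \<in> parcs G" "(x, x) \<notin> parcs G" for x y
    using pair_graph_sym pair_no_loops[of "(x, x)"] by (auto simp: sym_def)
  show ?thesis
  proof (rule pair_graphI)
    show "sym (parcs (compl_prism G))"
      unfolding compl_prism_def graph_compl_def sym_def using *(1) by auto
    show "irrefl (parcs (compl_prism G))"
      unfolding compl_prism_def graph_compl_def irrefl_def using *(2) by auto
  qed (use pair_finite_verts in \<open>auto simp: compl_prism_def graph_compl_def dest: wellformed'\<close>)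
qed

end

theory Submission
  imports Defs
begin

text \<open>
  A set of vertices of the prism is \<open>A <+> B\<close> with \<open>A\<close> in \<open>G\<close> and \<open>B\<close> in the complement, and so is
  its set of non-members. A vertex of one half has exactly one neighbour in the other half, so its
  number of neighbours in \<open>A <+> B\<close> exceeds the number of those in its own half by at most one.
  Hence the union of dominating sets of the two halves dominates the prism, and the two traces of
  a dominating set of the prism dominate the halves with \<open>k\<close> lowered by one.
\<close>

lemma tuple_total_restr_dom_number_le:
  "tuple_total_restr_dom k H S \<Longrightarrow> tuple_total_restr_dom_number k H \<le> card S"
  unfolding tuple_total_restr_dom_number_def by (rule Least_le) blast

text \<open>The set \<open>S\<close> serves only as evidence that the \<open>LEAST\<close> ranges
  over a nonempty set of cardinalities; otherwise its value would be unspecified.\<close>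

lemma tuple_total_restr_dom_number_attained:
  assumes "tuple_total_restr_dom k H S"
  obtains T where "tuple_total_restr_dom k H T" "card T = tuple_total_restr_dom_number k H"
  using LeastI_ex[of "\<lambda>m. \<exists>S. tuple_total_restr_dom k H S \<and> card S = m"] assms that
  unfolding tuple_total_restr_dom_number_def by blast

lemma (in pair_graph) ex_tuple_total_restr_dom:
  assumes "k \<le> min_degree G"
  shows "\<exists>S. tuple_total_restr_dom k G S"
  \<comment> \<open>Without vertices, \<open>min_degree\<close> is an unspecified
    \<open>Min {}\<close> and the assumption carries no information, but the degree condition is
    then vacuous.\<close>
  using assms le_min_degree_iff[of k] ex_tuple_total_restr_dom_iff[of k]
  by (cases "pverts G = {}") auto

lemma pverts_graph_compl [simp]: "pverts (graph_compl G) = pverts G"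
  by (simp add: graph_compl_def)

lemma pverts_compl_prism [simp]: "pverts (compl_prism G) = pverts G <+> pverts G"
  by (simp add: compl_prism_def)

text \<open>The summand \<open>{x}\<close> comes from the perfect matching, which has an edge at
  \<open>x\<close> only if \<open>x\<close> is a vertex.\<close>

lemma nbhd_compl_prism_Inl:
  "x \<in> pverts G \<Longrightarrow> nbhd (compl_prism G) (Inl x) = nbhd G x <+> {x}"
  by (auto simp: nbhd_def compl_prism_def)

lemma nbhd_compl_prism_Inr:
  "x \<in> pverts G \<Longrightarrow> nbhd (compl_prism G) (Inr x) = {x} <+> nbhd (graph_compl G) x"
  by (auto simp: nbhd_def compl_prism_def)

lemma Plus_Int_Plus: "(A <+> B) \<inter> (C <+> D) = (A \<inter> C) <+> (B \<inter> D)"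
  by auto

lemma Plus_Diff_Plus: "(A <+> B) - (C <+> D) = (A - C) <+> (B - D)"
  by auto

text \<open>Bounds the contribution of the matching edge to a neighbour count: this is the one lost
  in passing from the prism to a half.\<close>

lemma card_singleton_Int_le: "card ({x} \<inter> A) \<le> 1"
  using card_mono[of "{x}" "{x} \<inter> A"] by simp

context pair_graph
begin

lemma finite_nbhd: "finite (nbhd G x)"
  using nbhd_subset pair_finite_verts by (rule finite_subset)

text \<open>With \<open>A\<close> and \<open>B\<close> arbitrary, the count can be used both for a
  dominating set and for its set of non-members.\<close>

lemma card_nbhd_compl_prism_Inl:
  assumes "x \<in> pverts G"
  shows "card (nbhd (compl_prism G) (Inl x) \<inter> (A <+> B))
    = card (nbhd G x \<inter> A) + card ({x} \<inter> B)"
  using assms finite_nbhd by (simp add: nbhd_compl_prism_Inl Plus_Int_Plus card_Plus)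

lemma card_nbhd_compl_prism_Inr:
  assumes "x \<in> pverts G"
  shows "card (nbhd (compl_prism G) (Inr x) \<inter> (A <+> B))
    = card ({x} \<inter> A) + card (nbhd (graph_compl G) x \<inter> B)"
  using assms pair_graph.finite_nbhd[OF pair_graph_compl]
  by (simp add: nbhd_compl_prism_Inr Plus_Int_Plus card_Plus)

lemma tuple_total_restr_dom_compl_prism:
  assumes "tuple_total_restr_dom k G A" "tuple_total_restr_dom k (graph_compl G) B"
  shows "tuple_total_restr_dom k (compl_prism G) (A <+> B)"
  \<comment> \<open>The neighbours in the vertex's own half already suffice. They are the first
    summand of the count at \<open>Inl x\<close> and the second at \<open>Inr x\<close>, hence the
    two variants of \<open>trans_le_add\<close>.\<close>
  using assms
  by (auto simp: tuple_total_restr_dom_def tuple_total_dom_def Plus_Diff_Plus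
      card_nbhd_compl_prism_Inl card_nbhd_compl_prism_Inr intro: trans_le_add1)
    (meson DiffI trans_le_add1 trans_le_add2)+

lemma tuple_total_restr_dom_compl_prism_halves:
  assumes "tuple_total_restr_dom k (compl_prism G) (A <+> B)"
  shows "tuple_total_restr_dom (k - 1) G A"
    and "tuple_total_restr_dom (k - 1) (graph_compl G) B"
proof -
  have sub: "A \<subseteq> pverts G" "B \<subseteq> pverts G"
    using assms by (auto simp: tuple_total_restr_dom_def tuple_total_dom_def)
  have dom: "k \<le> card (nbhd (compl_prism G) v \<inter> (A <+> B))" if "v \<in> pverts G <+> pverts G" for v
    using assms that by (simp add: tuple_total_restr_dom_def tuple_total_dom_def)
  \<comment> \<open>The restrained condition has the same shape as \<open>dom\<close>, with the
    complements of \<open>A\<close> and \<open>B\<close> as the two summands, so the same count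
    applies.\<close>
  have restr: "k \<le> card (nbhd (compl_prism G) v \<inter> ((pverts G - A) <+> (pverts G - B)))"
    if "v \<in> (pverts G - A) <+> (pverts G - B)" for v
    using assms that by (simp add: tuple_total_restr_dom_def Plus_Diff_Plus)
  have "k - 1 \<le> card (nbhd G x \<inter> A)" if "x \<in> pverts G" for x
    using dom[OF InlI[OF that]] card_singleton_Int_le[of x B] that
    by (simp add: card_nbhd_compl_prism_Inl)
  moreover have "k - 1 \<le> card (nbhd G x \<inter> (pverts G - A))" if "x \<in> pverts G - A" for x
    using restr[OF InlI[OF that]] card_singleton_Int_le[of x "pverts G - B"] that
    by (simp add: card_nbhd_compl_prism_Inl)
  ultimately show "tuple_total_restr_dom (k - 1) G A"
    using sub by (simp add: tuple_total_restr_dom_def tuple_total_dom_def)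
  have "k - 1 \<le> card (nbhd (graph_compl G) x \<inter> B)" if "x \<in> pverts G" for x
    using dom[OF InrI[OF that]] card_singleton_Int_le[of x A] that
    by (simp add: card_nbhd_compl_prism_Inr)
  moreover have "k - 1 \<le> card (nbhd (graph_compl G) x \<inter> (pverts G - B))"
    if "x \<in> pverts G - B" for x
    using restr[OF InrI[OF that]] card_singleton_Int_le[of x "pverts G - A"] that
    by (simp add: card_nbhd_compl_prism_Inr)
  ultimately show "tuple_total_restr_dom (k - 1) (graph_compl G) B"
    using sub by (simp add: tuple_total_restr_dom_def tuple_total_dom_def)
qed

end

lemma card_Plus_subset:
  assumes "A \<subseteq> V" "B \<subseteq> V" "finite V"
  shows "card (A <+> B) = card A + card B"
  using assms by (meson card_Plus finite_subset)

theorem theorem5p4: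
  fixes G :: "'a pair_pre_digraph" and n k :: nat
  assumes "pair_graph G"
    and "card (pverts G) = n"
    and "k \<le> min (min_degree G) (min_degree (graph_compl G))"
  shows "(2 \<le> k \<longrightarrow>
            tuple_total_restr_dom_number (k - 1) G
              + tuple_total_restr_dom_number (k - 1) (graph_compl G)
            \<le> tuple_total_restr_dom_number k (compl_prism G))
       \<and> (1 \<le> k \<longrightarrow>
            tuple_total_restr_dom_number k (compl_prism G)
            \<le> tuple_total_restr_dom_number k G
              + tuple_total_restr_dom_number k (graph_compl G))"
proof -
  interpret pair_graph G by fact
  interpret compl: pair_graph "graph_compl G" by (rule pair_graph_compl)
  have sub: "S \<subseteq> pverts H" if "tuple_total_restr_dom k H S" for k S and H :: "'b pair_pre_digraph"
    using that by (simp add: tuple_total_restr_dom_def tuple_total_dom_def)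
  \<comment> \<open>The degree hypothesis enters here: it makes the minimum an attained one in
    \<open>G\<close> and, below, in its complement.\<close>
  obtain A where A: "tuple_total_restr_dom k G A" "card A = tuple_total_restr_dom_number k G"
    using ex_tuple_total_restr_dom assms(3) tuple_total_restr_dom_number_attained
    by (metis min.boundedE)
  obtain B where B: "tuple_total_restr_dom k (graph_compl G) B"
      "card B = tuple_total_restr_dom_number k (graph_compl G)"
    using compl.ex_tuple_total_restr_dom assms(3) tuple_total_restr_dom_number_attained
    by (metis min.boundedE)
  have AB: "tuple_total_restr_dom k (compl_prism G) (A <+> B)"
    using A(1) B(1) by (rule tuple_total_restr_dom_compl_prism)
  have upper: "tuple_total_restr_dom_number k (compl_prism G)
      \<le> tuple_total_restr_dom_number k G + tuple_total_restr_dom_number k (graph_compl G)"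
    using tuple_total_restr_dom_number_le[OF AB] A B sub[OF A(1)] sub[OF B(1)] pair_finite_verts
    by (simp add: card_Plus_subset)
  \<comment> \<open>Besides giving the upper bound, \<open>AB\<close> shows that the prism has a set
    of the required kind, so a minimum one exists.\<close>
  obtain T where T: "tuple_total_restr_dom k (compl_prism G) T"
      "card T = tuple_total_restr_dom_number k (compl_prism G)"
    using AB by (rule tuple_total_restr_dom_number_attained)
  \<comment> \<open>The traces of \<open>T\<close> on the two halves: they partition
    \<open>T\<close>, so their sizes add up to the number for the prism.\<close>
  define C D where "C = Inl -` T" and "D = Inr -` T"
  have T_eq: "T = C <+> D"
    unfolding C_def D_def by (auto simp: Plus_def image_iff) (metis sum.exhaust)
  note halves = tuple_total_restr_dom_compl_prism_halves[OF T(1)[unfolded T_eq]]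
  have "card T = card C + card D"
    using T_eq sub[OF halves(1)] sub[OF halves(2)] pair_finite_verts
    by (simp add: card_Plus_subset)
  then have "tuple_total_restr_dom_number (k - 1) G
      + tuple_total_restr_dom_number (k - 1) (graph_compl G)
      \<le> tuple_total_restr_dom_number k (compl_prism G)"
    using halves[THEN tuple_total_restr_dom_number_le] T(2) by linarith
  with upper show ?thesis by blast
qed

end
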